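(* Let $\mu_1,\mu_2,\mu_3,\mu_4$ be nonzero real numbers. There is only one possible inscribed trapezoid with three equal sides, other than the square, in the $(1+4)$-vortex problem with vortex ordering $v_1<v_2<v_3<v_4$. Namely, let $r^*\approx 2.79493$ be the largest positive root of the polynomial $$g(r)=-1+33r^2-202r^4+146r^6-117r^8+13r^{10}.$$ Then the angle of the spacing $\theta_2=\theta_2-\theta_1=\theta_3-\theta_2=\theta_4-\theta_3$ is $$\theta^*=\arcsin\left(\frac{2r^*}{1+(r^* )^2}\right)\approx0.687197,$$ and the circulation parameters $(\mu_1,\mu_2,\mu_3,\mu_4)$ lie in the set $$\bigl\{\bigl(b(r^* )\mu_2+a(r^* )\mu_3,\ \mu_2,\ \mu_3,\ a(r^* )\mu_2+b(r^* )\mu_3\bigr):\ \mu_2,\mu_3\in\mathbb{R}\bigr\},$$ where $$a(r)=\tfrac{1}{272}\bigl(-753+16124r^2-11428r^4+10036r^6-1131r^8\bigr),$$ $$b(r)=\tfrac{1}{4352}\bigl(2827-168410r^2+119616r^4-107718r^6+12181r^8\bigr).$$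
   Context: The $(1+4)$-vortex problem: a dominant vortex of circulation $1$ is at the origin, and four infinitesimal vortices $v_1,v_2,v_3,v_4$ with circulation parameters $\mu_i\in\mathbb{R}\setminus\{0\}$ lie on the unit circle, $v_i$ being at the point with polar coordinates $(1,\theta_i)$. Vortices do not collide, so the angles $\theta_i$ are pairwise distinct modulo $2\pi$. Define $$V(\theta)=-\sum_{1\le i<j\le 4}\mu_i\mu_j\left[\cos(\theta_i-\theta_j)+\tfrac12\log\bigl(2-2\cos(\theta_i-\theta_j)\bigr)\right].$$ A configuration of the $(1+4)$-vortex problem with circulation parameters $(\mu_1,\dots,\mu_4)$ means a critical point $\theta=(\theta_1,\dots,\theta_4)$ of $V$. An inscribed trapezoid with three equal sides with vortex ordering $v_1<v_2<v_3<v_4$ (counterclockwise around the circle) is, after rotating so that $\theta_1=0$, a configuration with $\theta_1=0$, $\theta_2\in(0,2\pi/3)$, $\theta_3=2\theta_2$, $\theta_4=3\theta_2$. It is the square when $\theta_2=\pi/2$. *)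

theory Defs
  imports "HOL-Analysis.Analysis" "HOL-Library.Real_Mod"
begin

text \<open>
  Circulation parameters and angles are vectors in \<open>real ^ 4\<close>. The index set of the sum
  (pairs \<open>i < j\<close>) is listed explicitly, because in the index type 4 the numeral \<open>4\<close>
  coincides with \<open>0\<close>, so that the order of that type is not \<open>1 < 2 < 3 < 4\<close>.
\<close>

definition vortex_potential :: "real ^ 4 \<Rightarrow> real ^ 4 \<Rightarrow> real" where
  "vortex_potential \<mu> \<theta> =
     - (\<Sum>(i, j)\<in>{(1, 2), (1, 3), (1, 4), (2, 3), (2, 4), (3, 4)}.
          \<mu> $ i * \<mu> $ j *
            (cos (\<theta> $ i - \<theta> $ j) + 1/2 * ln (2 - 2 * cos (\<theta> $ i - \<theta> $ j))))"

definition vortex_configuration :: "real ^ 4 \<Rightarrow> real ^ 4 \<Rightarrow> bool" where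
  "vortex_configuration \<mu> \<theta> \<longleftrightarrow>
     (\<forall>i j. i \<noteq> j \<longrightarrow> \<not> [\<theta> $ i = \<theta> $ j] (rmod (2 * pi))) \<and>
     (vortex_potential \<mu> has_derivative (\<lambda>_. 0)) (at \<theta>)"

text \<open>
  The trapezoid is normalized by a rotation so that the first vortex has angle 0. It is the
  square exactly when \<open>\<theta> $ 2 = pi / 2\<close>.
\<close>

definition three_equal_sides_trapezoid :: "real ^ 4 \<Rightarrow> bool" where
  "three_equal_sides_trapezoid \<theta> \<longleftrightarrow>
     \<theta> $ 1 = 0 \<and> \<theta> $ 2 \<in> {0<..<2 * pi / 3} \<and> \<theta> $ 3 = 2 * \<theta> $ 2 \<and> \<theta> $ 4 = 3 * \<theta> $ 2"

definition g_poly :: "real \<Rightarrow> real" where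
  "g_poly r = - 1 + 33 * r^2 - 202 * r^4 + 146 * r^6 - 117 * r^8 + 13 * r^10"

definition r_star :: real where
  "r_star = Max {r. r > 0 \<and> g_poly r = 0}"

lemma finite_pos_roots_g_poly: "finite {r. r > 0 \<and> g_poly r = 0}"
proof -
  let ?p = "[:-1, 0, 33, 0, -202, 0, 146, 0, -117, 0, 13:] :: real poly"
  have eq: "g_poly r = poly ?p r" for r
    by (simp add: g_poly_def algebra_simps power_numeral_reduce)
  have "finite {r. poly ?p r = 0}"
    by (rule poly_roots_finite) simp
  then show ?thesis
    unfolding eq by (rule rev_finite_subset) blast
qed

lemma pos_roots_g_poly_nonempty: "{r. r > 0 \<and> g_poly r = 0} \<noteq> {}"
proof -
  have "\<exists>r\<ge>1. r \<le> 3 \<and> g_poly r = 0"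
    by (rule IVT') (auto simp: g_poly_def intro!: continuous_intros)
  then show ?thesis
    by force
qed

lemma r_star_largest_pos_root:
  shows "r_star > 0" and "g_poly r_star = 0"
    and "\<And>r. r > 0 \<Longrightarrow> g_poly r = 0 \<Longrightarrow> r \<le> r_star"
  using Max_in[OF finite_pos_roots_g_poly pos_roots_g_poly_nonempty]
    Max_ge[OF finite_pos_roots_g_poly]
  by (auto simp: r_star_def)

definition theta_star :: real where
  "theta_star = arcsin (2 * r_star / (1 + r_star^2))"

definition a_coeff :: "real \<Rightarrow> real" where
  "a_coeff r = 1/272 * (- 753 + 16124 * r^2 - 11428 * r^4 + 10036 * r^6 - 1131 * r^8)"

definition b_coeff :: "real \<Rightarrow> real" where
  "b_coeff r =
     1/4352 * (2827 - 168410 * r^2 + 119616 * r^4 - 107718 * r^6 + 12181 * r^8)"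

end

theory Submission
  imports Defs
begin

text \<open>
  Criticality is linear in the circulations. The potential is a sum of pair energies
  \<open>- \<mu> i * \<mu> j * E (\<theta> i - \<theta> j)\<close> with \<open>E' = - interaction\<close>, and \<open>interaction\<close> is odd. As no
  \<open>\<mu> i\<close> vanishes, \<open>\<theta>\<close> is critical iff \<open>\<mu>\<close> lies in the kernel of the skew-symmetric matrix
  \<open>interaction (\<theta> i - \<theta> j)\<close> (\<open>vortex_configuration_iff\<close>). For a trapezoid of spacing \<open>t\<close> its
  entries are, up to sign, \<open>A\<close>, \<open>B\<close>, \<open>C\<close>, the interactions at \<open>t\<close>, \<open>2 t\<close>, \<open>3 t\<close>. A skew-symmetric
  \<open>4 \<times> 4\<close> matrix is singular iff its Pfaffian vanishes, here \<open>A\<^sup>2 - B\<^sup>2 + A * C\<close>.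

  The substitution \<open>u = cot\<^sup>2 (t / 2)\<close>, that is \<open>cos t = (u - 1) / (u + 1)\<close>, makes \<open>A\<close>, \<open>B\<close>, \<open>C\<close> into
  \<open>sin t\<close> times rational functions of \<open>u\<close>. The Pfaffian then becomes
  \<open>sin\<^sup>2 t * (u - 1) * (u + 1) * g u\<close> up to a nonzero factor, where \<open>g (r\<^sup>2) = g_poly r\<close>
  (\<open>pfaffian_factorization\<close>). The condition \<open>t < 2 * pi / 3\<close> says \<open>u > 1/3\<close>, and \<open>u = 1\<close> is the
  square. On \<open>u > 1/3\<close> the polynomial \<open>g\<close> is negative up to \<open>39/5\<close> and increasing afterwards, so
  it has one root there, which must be \<open>r_star\<^sup>2\<close> (\<open>g_reduced_root_unique\<close>). This determines \<open>t\<close>.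

  When the Pfaffian vanishes the kernel is a plane. As \<open>C\<close> is nonzero, the first and the last row
  give \<open>\<mu> 4\<close> and \<open>\<mu> 1\<close> in terms of \<open>\<mu> 2\<close> and \<open>\<mu> 3\<close> with coefficients \<open>- A / C\<close> and \<open>- B / C\<close>.
  These are rational in \<open>u\<close>, and reducing them modulo \<open>g\<close> yields the polynomials \<open>a_coeff\<close> and
  \<open>b_coeff\<close> (\<open>interaction_ratios\<close>). A nowhere vanishing kernel vector exists because the
  one with \<open>\<mu> 2 = \<mu> 3 = 1\<close> has outer entries \<open>- (A + B) / C \<noteq> 0\<close>.
\<close>

section \<open>Critical points as kernels of a skew-symmetric matrix\<close>

text \<open>
  The negated derivative of the pair energy \<open>cos x + ln (2 - 2 * cos x) / 2\<close>. Totalized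
  division gives it the value \<open>0\<close> at the singularity \<open>0\<close>, so that sums over all partners of a
  vortex may include the vortex itself.
\<close>

definition interaction :: "real \<Rightarrow> real" where
  "interaction x = sin x * (1 - 1 / (2 - 2 * cos x))"

lemma interaction_minus: "interaction (- x) = - interaction x"
  by (simp add: interaction_def)

lemma interaction_0 [simp]: "interaction 0 = 0"
  by (simp add: interaction_def)

lemma has_derivative_pair_energy:
  assumes "cos (\<theta> $ i - \<theta> $ j :: real) \<noteq> 1"
  shows "((\<lambda>\<theta>. cos (\<theta> $ i - \<theta> $ j) + 1/2 * ln (2 - 2 * cos (\<theta> $ i - \<theta> $ j)))
     has_derivative (\<lambda>h. - interaction (\<theta> $ i - \<theta> $ j) * (h $ i - h $ j))) (at \<theta>)"
proof -
  define x where "x = \<theta> $ i - \<theta> $ j"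
  have lt: "cos x < 1"
    using assms cos_le_one[of x] unfolding x_def by linarith
  have "((\<lambda>x. cos x + 1/2 * ln (2 - 2 * cos x)) has_real_derivative - interaction x) (at x)"
    using lt by (auto intro!: derivative_eq_intros simp: interaction_def field_simps)
  moreover have "((\<lambda>\<theta>. \<theta> $ i - \<theta> $ j) has_derivative (\<lambda>h. h $ i - h $ j)) (at \<theta>)"
    by (intro has_derivative_diff bounded_linear_imp_has_derivative bounded_linear_vec_nth)
  ultimately show ?thesis
    unfolding x_def by (rule DERIV_compose_FDERIV[THEN has_derivative_eq_rhs]) (simp add: fun_eq_iff)
qed

text \<open>
  Oddness of \<open>interaction\<close> turns the sum over pairs into a sum over all ordered pairs, which
  displays the partial derivatives as coefficients.
\<close>

lemma has_derivative_vortex_potential: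
  assumes "\<And>i j. i \<noteq> j \<Longrightarrow> cos (\<theta> $ i - \<theta> $ j) \<noteq> 1"
  shows "(vortex_potential \<mu> has_derivative
    (\<lambda>h. \<Sum>i\<in>UNIV. \<mu> $ i * (\<Sum>j\<in>UNIV. \<mu> $ j * interaction (\<theta> $ i - \<theta> $ j)) * h $ i)) (at \<theta>)"
proof -
  define P :: "(4 \<times> 4) set" where "P = {(1, 2), (1, 3), (1, 4), (2, 3), (2, 4), (3, 4)}"
  have ne: "i \<noteq> j" if "(i, j) \<in> P" for i j
    using that by (auto simp: P_def)
  have "vortex_potential \<mu> = (\<lambda>\<theta>. - (\<Sum>p\<in>P. \<mu> $ fst p * \<mu> $ snd p *
     (cos (\<theta> $ fst p - \<theta> $ snd p) + 1/2 * ln (2 - 2 * cos (\<theta> $ fst p - \<theta> $ snd p)))))"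
    by (simp add: fun_eq_iff vortex_potential_def P_def case_prod_beta)
  moreover have "(\<dots> has_derivative (\<lambda>h. - (\<Sum>p\<in>P. \<mu> $ fst p * \<mu> $ snd p *
      (- interaction (\<theta> $ fst p - \<theta> $ snd p) * (h $ fst p - h $ snd p))))) (at \<theta>)"
    by (intro has_derivative_minus has_derivative_sum has_derivative_mult_right
        has_derivative_pair_energy assms ne) simp
  moreover have "- (\<Sum>p\<in>P. \<mu> $ fst p * \<mu> $ snd p *
      (- interaction (\<theta> $ fst p - \<theta> $ snd p) * (h $ fst p - h $ snd p))) =
    (\<Sum>i\<in>UNIV. \<mu> $ i * (\<Sum>j\<in>UNIV. \<mu> $ j * interaction (\<theta> $ i - \<theta> $ j)) * h $ i)" for h :: "real ^ 4"
  proof -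
    have flip: "interaction (\<theta> $ i - \<theta> $ j) = - interaction (\<theta> $ j - \<theta> $ i)" for i j
      using interaction_minus[of "\<theta> $ j - \<theta> $ i"] by simp
    show ?thesis
      by (simp add: P_def sum_4 flip[of 2 1] flip[of 3 1] flip[of 4 1] flip[of 3 2] flip[of 4 2]
          flip[of 4 3] algebra_simps)
  qed
  ultimately show ?thesis
    by simp
qed

text \<open>The angles at which the pair energy is singular are exactly the collisions.\<close>

lemma cos_diff_eq_1_iff_rcong: "cos (x - y) = 1 \<longleftrightarrow> [x = y] (rmod (2 * pi))"
proof -
  have "cos (x - y) = 1 \<longleftrightarrow> (\<exists>n. x - y = of_int n * (2 * pi))"
    by (simp add: cos_one_2pi_int mult.assoc)
  also have "\<dots> \<longleftrightarrow> [y = x] (rmod (2 * pi))"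
    unfolding rcong_altdef by (simp add: algebra_simps)
  also have "\<dots> \<longleftrightarrow> [x = y] (rmod (2 * pi))"
    by (rule rcong_sym_iff)
  finally show ?thesis .
qed

lemma vortex_configuration_iff:
  assumes "\<And>i. \<mu> $ i \<noteq> 0" "\<And>i j. i \<noteq> j \<Longrightarrow> cos (\<theta> $ i - \<theta> $ j) \<noteq> 1"
  shows "vortex_configuration \<mu> \<theta> \<longleftrightarrow>
    (\<forall>i. (\<Sum>j\<in>UNIV. \<mu> $ j * interaction (\<theta> $ i - \<theta> $ j)) = 0)"
proof
  assume "vortex_configuration \<mu> \<theta>"
  then have "(vortex_potential \<mu> has_derivative (\<lambda>_. 0)) (at \<theta>)"
    by (simp add: vortex_configuration_def)
  from has_derivative_unique[OF has_derivative_vortex_potential[OF assms(2)] this]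
  have 0: "(\<Sum>i\<in>UNIV. \<mu> $ i * (\<Sum>j\<in>UNIV. \<mu> $ j * interaction (\<theta> $ i - \<theta> $ j)) * h $ i) = 0" for h
    by (auto simp: fun_eq_iff)
  show "\<forall>i. (\<Sum>j\<in>UNIV. \<mu> $ j * interaction (\<theta> $ i - \<theta> $ j)) = 0"
  proof
    fix k
    \<comment> \<open>The derivative in the direction of the \<open>k\<close>-th axis.\<close>
    have "\<mu> $ k * (\<Sum>j\<in>UNIV. \<mu> $ j * interaction (\<theta> $ k - \<theta> $ j)) = 0"
      using 0[of "axis k 1"] by (simp add: axis_def if_distrib cong: if_cong)
    then show "(\<Sum>j\<in>UNIV. \<mu> $ j * interaction (\<theta> $ k - \<theta> $ j)) = 0"
      using assms(1) by simp
  qed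
next
  assume "\<forall>i. (\<Sum>j\<in>UNIV. \<mu> $ j * interaction (\<theta> $ i - \<theta> $ j)) = 0"
  then show "vortex_configuration \<mu> \<theta>"
    using has_derivative_vortex_potential[OF assms(2), of \<mu>] assms(2)
    by (simp add: vortex_configuration_def cos_diff_eq_1_iff_rcong)
qed

section \<open>The trapezoid and its Pfaffian\<close>

text \<open>
  All pairwise differences of the angles are \<open>t\<close>, \<open>2 * t\<close> or \<open>3 * t\<close> up to sign. In absolute value
  they lie strictly between \<open>0\<close> and \<open>2 * pi\<close>, so there is no collision and the linear system applies.
\<close>

lemma trapezoid_vortex_configuration_iff:
  assumes "\<And>i. \<mu> $ i \<noteq> 0" "three_equal_sides_trapezoid \<theta>" "t = \<theta> $ 2"
    and "A = interaction t" "B = interaction (2 * t)" "C = interaction (3 * t)"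
  shows "vortex_configuration \<mu> \<theta> \<longleftrightarrow>
    A * \<mu> $ 2 + B * \<mu> $ 3 + C * \<mu> $ 4 = 0 \<and>
    A * \<mu> $ 1 = A * \<mu> $ 3 + B * \<mu> $ 4 \<and>
    B * \<mu> $ 1 + A * \<mu> $ 2 = A * \<mu> $ 4 \<and>
    C * \<mu> $ 1 + B * \<mu> $ 2 + A * \<mu> $ 3 = 0"
proof -
  have t: "0 < t" "t < 2 * pi / 3"
    and th: "\<theta> $ 1 = 0" "\<theta> $ 2 = t" "\<theta> $ 3 = 2 * t" "\<theta> $ 4 = 3 * t"
    using assms by (auto simp: three_equal_sides_trapezoid_def)
  have ne: "cos x \<noteq> 1" if "0 < \<bar>x\<bar>" "\<bar>x\<bar> < 2 * pi" for x
  proof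
    assume "cos x = 1"
    then obtain n :: int where "x = n * 2 * pi"
      by (auto simp: cos_one_2pi_int)
    with that show False
      by (cases "n = 0") (auto simp: abs_mult)
  qed
  have "cos t \<noteq> 1" "cos (2 * t) \<noteq> 1" "cos (3 * t) \<noteq> 1"
    using t ne[of t] ne[of "2 * t"] ne[of "3 * t"] by auto
  then have "\<forall>i j. i \<noteq> j \<longrightarrow> cos (\<theta> $ i - \<theta> $ j) \<noteq> 1"
    by (simp add: forall_4 th)
  then have "cos (\<theta> $ i - \<theta> $ j) \<noteq> 1" if "i \<noteq> j" for i j
    using that by blast
  then have iff: "vortex_configuration \<mu> \<theta> \<longleftrightarrow>
      (\<forall>i. (\<Sum>j\<in>UNIV. \<mu> $ j * interaction (\<theta> $ i - \<theta> $ j)) = 0)"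
    by (intro vortex_configuration_iff assms(1))
  have diff: "t - 2 * t = - t" "t - 3 * t = - (2 * t)" "2 * t - t = t" "2 * t - 3 * t = - t"
    "3 * t - t = 2 * t" "3 * t - 2 * t = t"
    by simp_all
  define S where "S i = (\<Sum>j\<in>UNIV. \<mu> $ j * interaction (\<theta> $ i - \<theta> $ j))" for i
  have "S 1 = - (A * \<mu> $ 2 + B * \<mu> $ 3 + C * \<mu> $ 4)"
    "S 2 = A * \<mu> $ 1 - (A * \<mu> $ 3 + B * \<mu> $ 4)"
    "S 3 = B * \<mu> $ 1 + A * \<mu> $ 2 - A * \<mu> $ 4"
    "S 4 = C * \<mu> $ 1 + B * \<mu> $ 2 + A * \<mu> $ 3"
    unfolding S_def sum_4 th assms(4-6)
    by (simp_all add: diff interaction_minus mult.commute)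
  then show ?thesis
    unfolding iff S_def[symmetric] by (auto simp: forall_4)
qed

text \<open>
  The product of a skew-symmetric \<open>4 \<times> 4\<close> matrix with its dual is the Pfaffian times the
  identity. The combination of rows used here is one row of that product.
\<close>

lemma pfaffian_eq_0_if_kernel:
  fixes A B C :: "'a :: idom"
  assumes "A * x1 = A * x3 + B * x4" "B * x1 + A * x2 = A * x4" "C * x1 + B * x2 + A * x3 = 0"
    and "x1 \<noteq> 0"
  shows "A\<^sup>2 - B\<^sup>2 + A * C = 0"
proof -
  have "(A\<^sup>2 - B\<^sup>2 + A * C) * x1 = A * (A * x1 - (A * x3 + B * x4))
    - B * (B * x1 + A * x2 - A * x4) + A * (C * x1 + B * x2 + A * x3)"
    by (simp add: algebra_simps power2_eq_square)
  then show ?thesis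
    using assms by simp
qed

text \<open>
  With \<open>u = cot\<^sup>2 (t / 2)\<close> the squared chords are \<open>2 - 2 * cos t = 4 / (u + 1)\<close>,
  \<open>2 - 2 * cos (2 * t) = 16 * u / (u + 1)\<^sup>2\<close> and
  \<open>2 - 2 * cos (3 * t) = 4 * (3 * u - 1)\<^sup>2 / (u + 1)\<^sup>3\<close>, all nonzero for \<open>u > 1/3\<close>. The conclusions are
  cleared of denominators so that later steps are polynomial identities.
\<close>

lemma interaction_multiple_angles:
  fixes t u :: real
  assumes u: "u > 1/3" and c: "cos t = (u - 1) / (u + 1)"
  defines "s \<equiv> sin t"
  shows "4 * interaction t = s * (3 - u)"
    and "8 * u * (u + 1) * interaction (2 * t) = s * (u - 1) * (14 * u - 1 - u\<^sup>2)"
    and "4 * (3 * u - 1) * (u + 1)\<^sup>2 * interaction (3 * t) = s * (u - 3) * (3 - 27 * u + 33 * u\<^sup>2 - u^3)"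
proof -
  have pos: "u > 0" "u + 1 > 0" "3 * u - 1 > 0"
    using u by auto
  have c1: "2 - 2 * cos t = 4 / (u + 1)"
    unfolding c using pos by (simp add: field_simps)
  have "1 - 1 / (2 - 2 * cos t) = (3 - u) / 4"
    unfolding c1 using pos by (simp add: field_simps)
  then show "4 * interaction t = s * (3 - u)"
    by (simp add: interaction_def s_def)
  have "2 - 2 * cos (2 * t) = 4 * (1 - (cos t)\<^sup>2)"
    by (simp add: cos_double_cos)
  also have "(cos t)\<^sup>2 = (u - 1)\<^sup>2 / (u + 1)\<^sup>2"
    unfolding c by (rule power_divide)
  also have "1 - \<dots> = ((u + 1)\<^sup>2 - (u - 1)\<^sup>2) / (u + 1)\<^sup>2"
    using pos by (subst diff_divide_distrib) simp
  also have "(u + 1)\<^sup>2 - (u - 1)\<^sup>2 = 4 * u"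
    by algebra
  finally have c2: "2 - 2 * cos (2 * t) = 16 * u / (u + 1)\<^sup>2"
    by simp
  have "interaction (2 * t) = 2 * s * ((u - 1) / (u + 1)) * (1 - (u + 1)\<^sup>2 / (16 * u))"
    unfolding interaction_def c2 sin_double c s_def by simp
  also have "8 * u * (u + 1) * \<dots> = s * (u - 1) * (16 * u * (1 - (u + 1)\<^sup>2 / (16 * u)))"
    using pos by simp
  also have "16 * u * (1 - (u + 1)\<^sup>2 / (16 * u)) = 16 * u - (u + 1)\<^sup>2"
    using pos by (simp add: right_diff_distrib)
  also have "\<dots> = 14 * u - 1 - u\<^sup>2"
    by algebra
  finally show "8 * u * (u + 1) * interaction (2 * t) = s * (u - 1) * (14 * u - 1 - u\<^sup>2)" .
  have "2 - 2 * cos (3 * t) = 2 * (1 - cos t) * (1 + 2 * cos t)\<^sup>2"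
    unfolding cos_treble_cos by algebra
  also have "\<dots> = 4 * (3 * u - 1)\<^sup>2 / (u + 1)^3"
  proof -
    have "1 - cos t = 2 / (u + 1)" "1 + 2 * cos t = (3 * u - 1) / (u + 1)"
      unfolding c using pos by (simp_all add: field_simps)
    then show ?thesis
      by (simp add: power_divide power2_eq_square power3_eq_cube)
  qed
  finally have c3: "2 - 2 * cos (3 * t) = 4 * (3 * u - 1)\<^sup>2 / (u + 1)^3" .
  have "sin (3 * t) = sin (2 * t) * cos t + cos (2 * t) * sin t"
    using sin_add[of "2 * t" t] by simp
  also have "\<dots> = s * (4 * (cos t)\<^sup>2 - 1)"
    unfolding sin_double cos_double_cos s_def by algebra
  also have "4 * (cos t)\<^sup>2 - 1 = (3 * u - 1) * (u - 3) / (u + 1)\<^sup>2"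
  proof -
    have "4 * (u - 1)\<^sup>2 - (u + 1)\<^sup>2 = (3 * u - 1) * (u - 3)"
      by algebra
    then show ?thesis
      unfolding c power_divide using pos by (simp add: divide_simps)
  qed
  finally have s3: "sin (3 * t) = s * ((3 * u - 1) * (u - 3) / (u + 1)\<^sup>2)" .
  have "4 * (3 * u - 1) * (u + 1)\<^sup>2 * interaction (3 * t) =
      s * (u - 3) * (4 * (3 * u - 1)\<^sup>2 * (1 - (u + 1)^3 / (4 * (3 * u - 1)\<^sup>2)))"
    unfolding interaction_def c3 s3 using pos by (simp add: power2_eq_square)
  also have "4 * (3 * u - 1)\<^sup>2 * (1 - (u + 1)^3 / (4 * (3 * u - 1)\<^sup>2)) = 4 * (3 * u - 1)\<^sup>2 - (u + 1)^3"
    using pos by (simp add: right_diff_distrib)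
  also have "\<dots> = 3 - 27 * u + 33 * u\<^sup>2 - u^3"
    by (simp add: algebra_simps power2_eq_square power3_eq_cube)
  finally show "4 * (3 * u - 1) * (u + 1)\<^sup>2 * interaction (3 * t) = s * (u - 3) * (3 - 27 * u + 33 * u\<^sup>2 - u^3)" .
qed

text \<open>The polynomial \<open>g_poly\<close> contains only even powers; this is its form in \<open>u = r\<^sup>2\<close>.\<close>

definition g_reduced :: "real \<Rightarrow> real" where
  "g_reduced u = - 1 + 33 * u - 202 * u^2 + 146 * u^3 - 117 * u^4 + 13 * u^5"

lemma g_poly_eq_g_reduced: "g_poly r = g_reduced (r\<^sup>2)"
  by (simp add: g_poly_def g_reduced_def flip: power_mult)

text \<open>
  The factor \<open>u - 1\<close> accounts for the square; \<open>u + 1\<close> and the factors on the left do not vanish for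
  \<open>u > 1/3\<close>. Hence other critical trapezoids correspond to roots of \<open>g_reduced\<close>.
\<close>

lemma pfaffian_factorization:
  assumes "u > 1/3" "cos t = (u - 1) / (u + 1)"
  shows "64 * u\<^sup>2 * (u + 1)\<^sup>2 * (3 * u - 1) *
      ((interaction t)\<^sup>2 - (interaction (2 * t))\<^sup>2 + interaction t * interaction (3 * t)) =
    (sin t)\<^sup>2 * (u - 1) * (u + 1) * g_reduced u"
proof -
  define A B C where ABC: "A = interaction t" "B = interaction (2 * t)" "C = interaction (3 * t)"
  note I = interaction_multiple_angles[OF assms, folded ABC]
  have "64 * u\<^sup>2 * (u + 1)\<^sup>2 * (3 * u - 1) * (A\<^sup>2 - B\<^sup>2 + A * C) =
    4 * u\<^sup>2 * (u + 1)\<^sup>2 * (3 * u - 1) * (4 * A)\<^sup>2 - (3 * u - 1) * (8 * u * (u + 1) * B)\<^sup>2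
    + 4 * u\<^sup>2 * (4 * A) * (4 * (3 * u - 1) * (u + 1)\<^sup>2 * C)"
    by algebra
  also have "\<dots> = (sin t)\<^sup>2 * (u - 1) * (u + 1) * g_reduced u"
    unfolding I g_reduced_def by algebra
  finally show ?thesis
    unfolding ABC .
qed

section \<open>Root isolation\<close>

text \<open>
  On \<open>[1/3, 1]\<close> the Taylor expansion at \<open>1/3\<close> has two positive terms, each dominated by the negative
  term before it, and the constant term is negative. At \<open>1\<close> every Taylor coefficient except the leading one is negative, and Horner's
  scheme bounds the value from above as long as \<open>u - 1 \<le> 34/5\<close>.
\<close>

lemma g_reduced_neg:
  assumes "1/3 \<le> u" "u \<le> 39/5"
  shows "g_reduced u < 0"
proof (cases "u \<le> 1")
  case True
  define v where "v = u - 1/3"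
  have v: "0 \<le> v" "v \<le> 2/3"
    using assms True by (auto simp: v_def)
  have "g_reduced u = - 2048/243 - 5632/81 * v - v\<^sup>2 * (3488/27 - 40/9 * v) - v^4 * (286/3 - 13 * v)"
    unfolding g_reduced_def v_def by algebra
  moreover have "v\<^sup>2 * (3488/27 - 40/9 * v) \<ge> 0" "v^4 * (286/3 - 13 * v) \<ge> 0"
    using v by (auto intro!: mult_nonneg_nonneg)
  ultimately show ?thesis
    using v by linarith
next
  case False
  define v where "v = u - 1"
  have v: "0 \<le> v" "v \<le> 34/5"
    using assms False by (auto simp: v_def)
  have step: "v * p \<le> 34/5 * q" if "p \<le> q" "0 \<le> q" for p q
    using mult_mono[OF v(2) that(1)] mult_left_mono[OF that(1) v(1)] mult_right_mono[OF v(2) that(2)]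
    by linarith
  have "g_reduced u = v * (v * (v * (v * (v * 13 - 52) - 192) - 336) - 336) - 128"
    unfolding g_reduced_def v_def by algebra
  moreover have "v * 13 - 52 \<le> 182/5"
    using v by simp
  then have "v * (v * 13 - 52) - 192 \<le> 56"
    using step[of _ "182/5"] by fastforce
  then have "v * (v * (v * 13 - 52) - 192) - 336 \<le> 45"
    using step[of _ 56] by fastforce
  then have "v * (v * (v * (v * 13 - 52) - 192) - 336) - 336 \<le> 0"
    using step[of _ 45] by fastforce
  then have "v * (v * (v * (v * (v * 13 - 52) - 192) - 336) - 336) \<le> 0"
    using v by (simp add: mult_nonneg_nonpos)
  ultimately show ?thesis
    by linarith
qed

text \<open>Grouping the derivative as below, each bracket is nonnegative from \<open>468/65 = 36/5\<close> on.\<close>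

lemma g_reduced_strict_mono:
  assumes "39/5 \<le> u" "u < v"
  shows "g_reduced u < g_reduced v"
proof (rule DERIV_pos_imp_increasing[OF assms(2)])
  fix x assume x: "u \<le> x" "x \<le> v"
  define d where "d = 33 + x * (438 * x - 404) + x^3 * (65 * x - 468)"
  have "(g_reduced has_real_derivative d) (at x)"
    unfolding g_reduced_def[abs_def] d_def
    by (auto intro!: derivative_eq_intros simp: algebra_simps power_numeral_reduce)
  moreover have "d > 0"
    unfolding d_def using x assms by (intro add_pos_nonneg mult_nonneg_nonneg) auto
  ultimately show "\<exists>d. (g_reduced has_real_derivative d) (at x) \<and> 0 < d"
    by blast
qed

lemma g_reduced_mono: "39/5 \<le> u \<Longrightarrow> u \<le> v \<Longrightarrow> g_reduced u \<le> g_reduced v"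
  using g_reduced_strict_mono[of u v] by (cases "u = v") auto

lemma g_reduced_root_unique:
  assumes "1/3 < u" "g_reduced u = 0" "1/3 < v" "g_reduced v = 0"
  shows "u = v"
proof -
  have "u > 39/5" "v > 39/5"
    using g_reduced_neg[of u] g_reduced_neg[of v] assms by force+
  then show ?thesis
    using g_reduced_strict_mono[of u v] g_reduced_strict_mono[of v u] assms by force
qed

text \<open>
  A root between \<open>1\<close> and \<open>3\<close> makes the largest root at least \<open>1\<close>, hence its square past \<open>39/5\<close>, into the
  range where \<open>g_reduced\<close> increases; there, signs at two points enclose the root. The enclosure is
  narrow enough to determine \<open>theta_star\<close> to six decimals.
\<close>

lemma r_star_bounds: "2.79493 < r_star" "r_star < 2.794931"
proof -
  have root: "g_reduced (r_star\<^sup>2) = 0" "r_star > 0"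
    using r_star_largest_pos_root by (simp_all add: g_poly_eq_g_reduced)
  have "\<exists>r\<ge>1. r \<le> 3 \<and> g_poly r = 0"
    by (rule IVT') (auto simp: g_poly_def intro!: continuous_intros)
  then obtain r where "r \<ge> 1" "g_poly r = 0"
    by blast
  then have "r_star \<ge> 1"
    using r_star_largest_pos_root(3)[of r] by linarith
  then have "r_star\<^sup>2 \<ge> 1"
    by simp
  then have large: "r_star\<^sup>2 > 39/5"
    using g_reduced_neg[of "r_star\<^sup>2"] root by force
  have neg: "g_reduced (2.79493\<^sup>2) < 0" and pos: "g_reduced (2.794931\<^sup>2) > 0"
    by (simp_all add: g_reduced_def power_divide)
  show "2.79493 < r_star"
  proof (rule ccontr)
    assume "\<not> 2.79493 < r_star"
    then have "r_star\<^sup>2 \<le> 2.79493\<^sup>2"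
      using root by (intro power_mono) auto
    from g_reduced_mono[OF less_imp_le[OF large] this] show False
      using neg root by linarith
  qed
  show "r_star < 2.794931"
  proof (rule ccontr)
    assume "\<not> r_star < 2.794931"
    then have "2.794931\<^sup>2 \<le> r_star\<^sup>2"
      by (intro power_mono) auto
    moreover have "39/5 \<le> (2.794931 :: real)\<^sup>2"
      by (simp add: power_divide)
    ultimately have "g_reduced (2.794931\<^sup>2) \<le> g_reduced (r_star\<^sup>2)"
      by (intro g_reduced_mono)
    then show False
      using pos root by linarith
  qed
qed

lemma r_star_sq_root: "g_reduced (r_star\<^sup>2) = 0"
  using r_star_largest_pos_root(2) by (simp add: g_poly_eq_g_reduced)

lemma r_star_sq_bounds: "7.8 < r_star\<^sup>2" "r_star\<^sup>2 < 7.82"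
proof -
  have "2.79493\<^sup>2 < r_star\<^sup>2" "r_star\<^sup>2 < 2.794931\<^sup>2"
    using r_star_bounds by (auto intro!: power_strict_mono)
  then show "7.8 < r_star\<^sup>2" "r_star\<^sup>2 < 7.82"
    by (simp_all add: power_divide)
qed

section \<open>The angle of the spacing\<close>

lemma half_chord_le_1: "2 * r / (1 + r\<^sup>2) \<le> (1 :: real)"
proof -
  have "0 \<le> (r - 1)\<^sup>2" "1 + r\<^sup>2 > 0"
    by (simp_all add: add_pos_nonneg)
  then show ?thesis
    by (simp add: power2_diff)
qed

text \<open>
  The sine is \<open>2 * r / (1 + r\<^sup>2)\<close> for both the angle \<open>2 * arctan (1 / r)\<close> and its supplement;
  \<open>1 \<le> r\<close> says that the arcsine selects the former, so that the cosine is nonnegative.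
\<close>

lemma arcsin_half_angle:
  assumes "1 \<le> r"
  shows "sin (arcsin (2 * r / (1 + r\<^sup>2))) = 2 * r / (1 + r\<^sup>2)"
    and "cos (arcsin (2 * r / (1 + r\<^sup>2))) = (r\<^sup>2 - 1) / (r\<^sup>2 + 1)"
proof -
  have pos: "1 + r\<^sup>2 > 0"
    by (simp add: add_pos_nonneg)
  note le = half_chord_le_1[of r]
  have ge: "0 \<le> 2 * r / (1 + r\<^sup>2)"
    using assms pos by simp
  show "sin (arcsin (2 * r / (1 + r\<^sup>2))) = 2 * r / (1 + r\<^sup>2)"
    using le ge by (intro sin_arcsin) linarith+
  have "1 - (2 * r / (1 + r\<^sup>2))\<^sup>2 = ((1 + r\<^sup>2)\<^sup>2 - (2 * r)\<^sup>2) / (1 + r\<^sup>2)\<^sup>2"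
    using pos by (subst diff_divide_distrib) (simp add: power_divide)
  also have "(1 + r\<^sup>2)\<^sup>2 - (2 * r)\<^sup>2 = (r\<^sup>2 - 1)\<^sup>2"
    by algebra
  finally have "1 - (2 * r / (1 + r\<^sup>2))\<^sup>2 = ((r\<^sup>2 - 1) / (r\<^sup>2 + 1))\<^sup>2"
    by (simp add: power_divide add.commute)
  moreover have "0 \<le> (r\<^sup>2 - 1) / (r\<^sup>2 + 1)"
    using assms by simp
  moreover have "cos (arcsin (2 * r / (1 + r\<^sup>2))) = sqrt (1 - (2 * r / (1 + r\<^sup>2))\<^sup>2)"
    using le ge by (intro cos_arcsin) linarith+
  ultimately show "cos (arcsin (2 * r / (1 + r\<^sup>2))) = (r\<^sup>2 - 1) / (r\<^sup>2 + 1)"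
    by (simp only: real_sqrt_unique)
qed

lemma cos_theta_star: "cos theta_star = (r_star\<^sup>2 - 1) / (r_star\<^sup>2 + 1)"
  unfolding theta_star_def by (rule arcsin_half_angle) (use r_star_bounds in simp)

lemma sin_theta_star: "sin theta_star = 2 * r_star / (1 + r_star\<^sup>2)"
  unfolding theta_star_def by (rule arcsin_half_angle) (use r_star_bounds in simp)

text \<open>
  The sine increases on \<open>[-pi/2, pi/2]\<close>, so it suffices to compare \<open>sin theta_star\<close> with the sines of
  the two bounds, which the Taylor polynomial of degree 9 (remainder \<open>x\<^sup>1\<^sup>1 / 11!\<close>) gives
  to more than enough decimals.
\<close>

lemma theta_star_bounds: "0.6871965 < theta_star" "theta_star < 0.6871975"
proof -
  \<comment> \<open>For \<open>r \<ge> 1\<close> the map \<open>r \<mapsto> 2 * r / (1 + r\<^sup>2)\<close> is decreasing, which carries the enclosure of \<open>r_star\<close> over.\<close>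
  have dec: "2 * q / (1 + q\<^sup>2) \<le> 2 * p / (1 + p\<^sup>2)" if "1 \<le> p" "p \<le> q" for p q :: real
  proof -
    have "0 \<le> (q - p) * (p * q - 1)"
      using that mult_mono[of 1 p 1 q] by (intro mult_nonneg_nonneg) auto
    then have "q * (1 + p\<^sup>2) \<le> p * (1 + q\<^sup>2)"
      by (simp add: algebra_simps power2_eq_square)
    moreover have "0 < 1 + p\<^sup>2" "0 < 1 + q\<^sup>2"
      by (simp_all add: add_pos_nonneg)
    ultimately show ?thesis
      by (simp add: divide_simps mult.commute)
  qed
  define T where "T x = x - x^3 / 6 + x^5 / 120 - x^7 / 5040 + x^9 / 362880" for x :: real
  have taylor: "T x - x^11 / 39916800 \<le> sin x" "sin x \<le> T x + x^11 / 39916800" if "0 \<le> x" for x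
  proof -
    have "\<bar>sin x - T x\<bar> \<le> x^11 / 39916800"
      using Maclaurin_sin_bound[of x 11] that
      by (simp add: T_def sin_coeff_def lessThan_nat_numeral fact_numeral algebra_simps)
    then show "T x - x^11 / 39916800 \<le> sin x" "sin x \<le> T x + x^11 / 39916800"
      by linarith+
  qed
  have "sin 0.6871965 \<le> T 0.6871965 + (0.6871965 :: real)^11 / 39916800"
    by (rule taylor) simp
  also have "\<dots> < 2 * 2.794931 / (1 + 2.794931\<^sup>2)"
    by (simp add: T_def power_divide)
  also have "\<dots> \<le> sin theta_star"
    unfolding sin_theta_star using r_star_bounds by (intro dec) auto
  finally have lo: "sin 0.6871965 < sin theta_star" .
  have "sin theta_star \<le> 2 * 2.79493 / (1 + 2.79493\<^sup>2)"
    unfolding sin_theta_star using r_star_bounds by (intro dec) auto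
  also have "\<dots> < T 0.6871975 - (0.6871975 :: real)^11 / 39916800"
    by (simp add: T_def power_divide)
  also have "\<dots> \<le> sin 0.6871975"
    by (rule taylor) simp
  finally have hi: "sin theta_star < sin 0.6871975" .
  have range: "- (pi / 2) \<le> theta_star" "theta_star \<le> pi / 2"
  proof -
    have "0 \<le> 2 * r_star / (1 + r_star\<^sup>2)"
      using r_star_bounds by (intro divide_nonneg_nonneg) auto
    then show "- (pi / 2) \<le> theta_star" "theta_star \<le> pi / 2"
      using arcsin_bounded[OF _ half_chord_le_1[of r_star]] by (auto simp: theta_star_def)
  qed
  show "0.6871965 < theta_star" "theta_star < 0.6871975"
    using lo hi range pi_gt3 by (auto simp: sin_mono_less_eq)
qed

text \<open>
  Put \<open>u = (1 + cos t) / (1 - cos t)\<close>. A nonzero kernel vector makes the Pfaffian vanish, and \<open>u \<noteq> 1\<close>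
  away from the square, so \<open>u\<close> is the root \<open>r_star\<^sup>2\<close>. The cosine then determines the angle.
\<close>

lemma critical_trapezoid_angle:
  assumes mu: "\<And>i. \<mu> $ i \<noteq> 0" and conf: "vortex_configuration \<mu> \<theta>"
    and trap: "three_equal_sides_trapezoid \<theta>" "\<theta> $ 2 \<noteq> pi / 2"
  shows "\<theta> $ 2 = theta_star"
proof -
  define t where "t = \<theta> $ 2"
  define u where "u = (1 + cos t) / (1 - cos t)"
  have t: "0 < t" "t < 2 * (pi / 3)"
    using trap by (auto simp: three_equal_sides_trapezoid_def t_def)
  have "cos (2 * (pi / 3)) < cos t"
    using t pi_gt_zero by (intro cos_monotone_0_pi) auto
  then have "- 1/2 < cos t"
    unfolding cos_double_cos cos_60 by (simp add: power2_eq_square)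
  moreover have "cos t < 1"
    using t pi_gt_zero cos_monotone_0_pi[of 0 t] by simp
  ultimately have u: "u > 1/3" and c: "cos t = (u - 1) / (u + 1)"
    by (simp_all add: u_def field_simps)
  have "sin t > 0"
    using t pi_gt_zero by (intro sin_gt_zero) auto
  have "u \<noteq> 1"
  proof
    assume "u = 1"
    then have "cos t = cos (pi / 2)"
      using c by simp
    then have "t = pi / 2"
      using t pi_gt_zero cos_inj_pi[of t "pi / 2"] by simp
    then show False
      using trap t_def by simp
  qed
  have "(interaction t)\<^sup>2 - (interaction (2 * t))\<^sup>2 + interaction t * interaction (3 * t) = 0"
    using trapezoid_vortex_configuration_iff[OF mu trap(1) t_def refl refl refl] conf mu
    by (intro pfaffian_eq_0_if_kernel) auto
  then have "g_reduced u = 0"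
    using pfaffian_factorization[OF u c] \<open>sin t > 0\<close> u \<open>u \<noteq> 1\<close> by simp
  then have "u = r_star\<^sup>2"
    using g_reduced_root_unique u r_star_sq_root r_star_sq_bounds by simp
  then have "cos t = cos theta_star"
    using c cos_theta_star by simp
  then show ?thesis
    using t theta_star_bounds pi_gt3 cos_inj_pi[of t theta_star] by (simp add: t_def)
qed

section \<open>The circulations\<close>

text \<open>
  Here \<open>- A / C = (3 * u - 1) * (u + 1)\<^sup>2 / D\<close>, and \<open>- B / C\<close> has denominator
  \<open>2 * u * (u - 3) * D\<close>. That \<open>a_coeff\<close> and \<open>b_coeff\<close> represent these fractions at the root is
  certified by the polynomial quotients by \<open>g_reduced\<close> in the steps \<open>a\<close> and \<open>b\<close>. The last claim
  makes the circulations in \<open>trapezoid_configuration_exists\<close> nonzero.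
\<close>

lemma interaction_ratios:
  defines "A \<equiv> interaction theta_star" and "B \<equiv> interaction (2 * theta_star)"
    and "C \<equiv> interaction (3 * theta_star)"
  shows "C \<noteq> 0" "A = - (a_coeff r_star * C)" "B = - (b_coeff r_star * C)"
    and "A\<^sup>2 - B\<^sup>2 + A * C = 0" and "A + B \<noteq> 0"
proof -
  define u s where "u = r_star\<^sup>2" and "s = sin theta_star"
  define D where "D = 3 - 27 * u + 33 * u\<^sup>2 - u^3"
  have u: "7.8 < u" "u < 7.82" "u > 1/3" and g: "g_reduced u = 0"
    using r_star_sq_bounds r_star_sq_root by (auto simp: u_def)
  have "s \<noteq> 0"
    using r_star_bounds add_pos_nonneg[of 1 "r_star\<^sup>2"] by (auto simp: s_def sin_theta_star)
  note I = interaction_multiple_angles[OF u(3) cos_theta_star[folded u_def],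
      folded A_def B_def C_def s_def D_def]
  \<comment> \<open>\<open>D\<close> is the only factor of \<open>C\<close> whose sign is not immediate.\<close>
  have "D = 3 + u * (u * (33 - u) - 27)"
    by (simp add: D_def algebra_simps power2_eq_square power3_eq_cube)
  moreover have "2 * 20 \<le> u * (33 - u)"
    using u by (intro mult_mono) auto
  ultimately have "D > 0"
    using u by (simp add: add_pos_nonneg)
  then have "4 * (3 * u - 1) * (u + 1)\<^sup>2 * C \<noteq> 0"
    unfolding I using u \<open>s \<noteq> 0\<close> by simp
  then show "C \<noteq> 0"
    by auto
  have "272 * a_coeff r_star = - 753 + 16124 * u - 11428 * u^2 + 10036 * u^3 - 1131 * u^4"
    by (simp add: a_coeff_def u_def flip: power_mult)
  then have a: "a_coeff r_star * D - (3 * u - 1) * (u + 1)\<^sup>2 = g_reduced u * (1987 - 2860 * u + 87 * u\<^sup>2) / 272"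
    unfolding D_def g_reduced_def by algebra
  have "4 * (3 * u - 1) * (u + 1)\<^sup>2 * (A + a_coeff r_star * C) =
    (3 * u - 1) * (u + 1)\<^sup>2 * (4 * A) + a_coeff r_star * (4 * (3 * u - 1) * (u + 1)\<^sup>2 * C)"
    by algebra
  also have "\<dots> = s * (u - 3) * (a_coeff r_star * D - (3 * u - 1) * (u + 1)\<^sup>2)"
    unfolding I by algebra
  also have "\<dots> = 0"
    unfolding a g by simp
  finally show "A = - (a_coeff r_star * C)"
    using u by simp
  have "4352 * b_coeff r_star = 2827 - 168410 * u + 119616 * u^2 - 107718 * u^3 + 12181 * u^4"
    by (simp add: b_coeff_def u_def flip: power_mult)
  then have b: "2 * u * (u - 3) * b_coeff r_star * D + (u - 1) * (14 * u - 1 - u\<^sup>2) * (3 * u - 1) * (u + 1) =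
      g_reduced u * (2176 + 60259 * u - 112771 * u\<^sup>2 + 33585 * u^3 - 937 * u^4) / 2176"
    unfolding D_def g_reduced_def by algebra
  have "8 * u * (3 * u - 1) * (u + 1)\<^sup>2 * (B + b_coeff r_star * C) =
    (3 * u - 1) * (u + 1) * (8 * u * (u + 1) * B) + 2 * u * b_coeff r_star * (4 * (3 * u - 1) * (u + 1)\<^sup>2 * C)"
    by algebra
  also have "\<dots> = s * (2 * u * (u - 3) * b_coeff r_star * D + (u - 1) * (14 * u - 1 - u\<^sup>2) * (3 * u - 1) * (u + 1))"
    unfolding I by algebra
  also have "\<dots> = 0"
    unfolding b g by simp
  finally show "B = - (b_coeff r_star * C)"
    using u by simp
  show "A\<^sup>2 - B\<^sup>2 + A * C = 0"
    using pfaffian_factorization[OF u(3) cos_theta_star[folded u_def]] g u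
    by (simp add: A_def B_def C_def)
  have "8 * u * (u + 1) * (A + B) = s * (u * (u * (19 - 3 * u) - 9) + 1)"
    using I(1,2) by algebra
  moreover have "u * (19 - 3 * u) < 0"
    using u by (intro mult_pos_neg) auto
  then have "u * (u * (19 - 3 * u) - 9) \<le> 7 * (-9)"
    using u mult_mono[of 7 u 9 "9 - u * (19 - 3 * u)"] by (simp add: algebra_simps)
  ultimately show "A + B \<noteq> 0"
    using \<open>s \<noteq> 0\<close> by auto
qed

lemma vector_4:
  "(vector [w, x, y, z] :: 'a :: zero ^ 4) $ 1 = w" "(vector [w, x, y, z] :: 'a ^ 4) $ 2 = x"
  "(vector [w, x, y, z] :: 'a ^ 4) $ 3 = y" "(vector [w, x, y, z] :: 'a ^ 4) $ 4 = z"
  unfolding vector_def by simp_all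

text \<open>
  Reversing the order of the vortices negates the matrix, so its kernel is invariant under
  reversal. This suggests looking for a symmetric vector \<open>(m, 1, 1, m)\<close>.
\<close>

lemma trapezoid_configuration_exists:
  "\<exists>(\<mu> :: real ^ 4) (\<theta> :: real ^ 4). (\<forall>i. \<mu> $ i \<noteq> 0) \<and> vortex_configuration \<mu> \<theta> \<and>
     three_equal_sides_trapezoid \<theta> \<and> \<theta> $ 2 \<noteq> pi / 2"
proof -
  define A B C where ABC: "A = interaction theta_star" "B = interaction (2 * theta_star)"
    "C = interaction (3 * theta_star)"
  note R = interaction_ratios[folded ABC]
  define m where "m = - (A + B) / C"
  have "m \<noteq> 0" and Cm: "C * m = - (A + B)"
    using R by (auto simp: m_def)
  \<comment> \<open>The two middle equations follow from the outer ones because the Pfaffian vanishes.\<close>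
  have "C * (A * m - (A + B * m)) = 0" "C * (B * m + A - A * m) = 0"
    using Cm R(4) by algebra+
  then have AB: "A * m = A + B * m" "B * m + A = A * m"
    using R(1) by auto
  define \<theta> :: "real ^ 4" where "\<theta> = vector [0, theta_star, 2 * theta_star, 3 * theta_star]"
  define \<mu> :: "real ^ 4" where "\<mu> = vector [m, 1, 1, m]"
  have th: "\<theta> $ 1 = 0" "\<theta> $ 2 = theta_star" "\<theta> $ 3 = 2 * theta_star" "\<theta> $ 4 = 3 * theta_star"
    by (simp_all add: \<theta>_def vector_4)
  have mu: "\<mu> $ 1 = m" "\<mu> $ 2 = 1" "\<mu> $ 3 = 1" "\<mu> $ 4 = m"
    by (simp_all add: \<mu>_def vector_4)
  have nz: "\<mu> $ i \<noteq> 0" for i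
    using exhaust_4[of i] mu \<open>m \<noteq> 0\<close> by auto
  have trap: "three_equal_sides_trapezoid \<theta>" "\<theta> $ 2 \<noteq> pi / 2"
    using theta_star_bounds pi_gt3 by (auto simp: three_equal_sides_trapezoid_def th)
  have "vortex_configuration \<mu> \<theta>"
    using trapezoid_vortex_configuration_iff[OF nz trap(1) refl refl refl refl] AB Cm
    by (simp add: th mu ABC)
  then show ?thesis
    using nz trap by blast
qed

theorem corollary1:
  shows "\<bar>r_star - 2.79493\<bar> < 0.000005 \<and>
    \<bar>theta_star - 0.687197\<bar> < 0.0000005 \<and>
    (\<exists>(\<mu> :: real ^ 4) (\<theta> :: real ^ 4).
       (\<forall>i. \<mu> $ i \<noteq> 0) \<and> vortex_configuration \<mu> \<theta> \<and>
       three_equal_sides_trapezoid \<theta> \<and> \<theta> $ 2 \<noteq> pi / 2) \<and>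
    (\<forall>(\<mu> :: real ^ 4) (\<theta> :: real ^ 4).
       (\<forall>i. \<mu> $ i \<noteq> 0) \<longrightarrow> vortex_configuration \<mu> \<theta> \<longrightarrow>
       three_equal_sides_trapezoid \<theta> \<longrightarrow> \<theta> $ 2 \<noteq> pi / 2 \<longrightarrow>
         \<theta> $ 2 = theta_star \<and> \<theta> $ 2 - \<theta> $ 1 = theta_star \<and>
         \<theta> $ 3 - \<theta> $ 2 = theta_star \<and> \<theta> $ 4 - \<theta> $ 3 = theta_star \<and>
         \<mu> \<in> {vector [b_coeff r_star * \<mu>2 + a_coeff r_star * \<mu>3, \<mu>2, \<mu>3,
                      a_coeff r_star * \<mu>2 + b_coeff r_star * \<mu>3] | \<mu>2 \<mu>3. True})"
proof (intro conjI allI impI)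
  show "\<bar>r_star - 2.79493\<bar> < 0.000005"
    using r_star_bounds unfolding abs_less_iff by simp
  show "\<bar>theta_star - 0.687197\<bar> < 0.0000005"
    using theta_star_bounds unfolding abs_less_iff by simp
  show "\<exists>(\<mu> :: real ^ 4) (\<theta> :: real ^ 4). (\<forall>i. \<mu> $ i \<noteq> 0) \<and> vortex_configuration \<mu> \<theta> \<and>
     three_equal_sides_trapezoid \<theta> \<and> \<theta> $ 2 \<noteq> pi / 2"
    by (rule trapezoid_configuration_exists)
next
  fix \<mu> \<theta> :: "real ^ 4"
  assume asms: "\<forall>i. \<mu> $ i \<noteq> 0" "vortex_configuration \<mu> \<theta>" "three_equal_sides_trapezoid \<theta>"
    "\<theta> $ 2 \<noteq> pi / 2"
  then show th2: "\<theta> $ 2 = theta_star"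
    using critical_trapezoid_angle by blast
  with asms(3) show "\<theta> $ 2 - \<theta> $ 1 = theta_star" "\<theta> $ 3 - \<theta> $ 2 = theta_star"
    "\<theta> $ 4 - \<theta> $ 3 = theta_star"
    by (simp_all add: three_equal_sides_trapezoid_def)
  define A B C where ABC: "A = interaction theta_star" "B = interaction (2 * theta_star)"
    "C = interaction (3 * theta_star)"
  note R = interaction_ratios[folded ABC]
  have eqs: "A * \<mu> $ 2 + B * \<mu> $ 3 + C * \<mu> $ 4 = 0" "C * \<mu> $ 1 + B * \<mu> $ 2 + A * \<mu> $ 3 = 0"
    using trapezoid_vortex_configuration_iff[OF _ asms(3) th2[symmetric] ABC] asms by auto
  have "C * (\<mu> $ 1 - (b_coeff r_star * \<mu> $ 2 + a_coeff r_star * \<mu> $ 3)) = 0"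
    "C * (\<mu> $ 4 - (a_coeff r_star * \<mu> $ 2 + b_coeff r_star * \<mu> $ 3)) = 0"
    using eqs R(2,3) by algebra+
  then have "\<mu> = vector [b_coeff r_star * \<mu> $ 2 + a_coeff r_star * \<mu> $ 3, \<mu> $ 2, \<mu> $ 3,
      a_coeff r_star * \<mu> $ 2 + b_coeff r_star * \<mu> $ 3]"
    using R(1) by (simp add: vec_eq_iff forall_4 vector_4)
  then show "\<mu> \<in> {vector [b_coeff r_star * \<mu>2 + a_coeff r_star * \<mu>3, \<mu>2, \<mu>3,
      a_coeff r_star * \<mu>2 + b_coeff r_star * \<mu>3] | \<mu>2 \<mu>3. True}"
    by blast
qed

end
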